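(* Let $a$ be a non-negative integer which is either $0$ or not a multiple of $10$. Then the constant congruence speed $V(a)$ of $a$ is given by $$V(a)=\begin{cases} 0 & \text{if } a\in\{0,1\},\\ \min\{v_2(a-1),v_5(a-1)\} & \text{if } a\equiv 1 \pmod{100} \text{ and } a\neq 1,\\ \min\{v_2(a+1),v_5(a-1)\} & \text{if } a\equiv 51 \pmod{100},\\ v_5(a^2+1) & \text{if } a\equiv 2 \text{ or } 8 \pmod{10},\\ \min\{v_2(a+1),v_5(a^2+1)\} & \text{if } a\equiv 7 \text{ or } 43 \pmod{100},\\ \min\{v_2(a-1),v_5(a^2+1)\} & \text{if } a\equiv 57 \text{ or } 93 \pmod{100},\\ v_5(a+1) & \text{if } a\equiv 4 \pmod{10},\\ v_2(a^2-1)-1 & \text{if } a\equiv 5 \pmod{10},\\ v_5(a-1) & \text{if } a\equiv 6 \pmod{10},\\ \min\{v_2(a-1),v_5(a+1)\} & \text{if } a\equiv 49 \pmod{100},\\ \min\{v_2(a+1),v_5(a+1)\} & \text{if } a\equiv 99 \pmod{100},\\ 1 & \text{otherwise.} \end{cases}$$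
   Context: For a prime $p$, $v_p$ denotes the $p$-adic valuation on $\mathbb{Z}$. For an integer $a\ge 1$, the tetration ${}^{b}a$ is defined by ${}^{1}a=a$ and ${}^{b}a=a^{({}^{b-1}a)}$ for $b\ge 2$. For an integer $a\ge 2$ not divisible by $10$ and $b\ge 1$, let $\#S(a,b)$ be the non-negative integer $n$ such that ${}^{b}a\equiv {}^{b+1}a \pmod{10^{n}}$ and ${}^{b}a\not\equiv {}^{b+1}a\pmod{10^{n+1}}$. The congruence speed of $a$ at height $b$ is $V(a,b):=\#S(a,b)-\#S(a,b-1)$ for $b\ge 2$ and $V(a,1):=\#S(a,1)$, so that $\#S(a,b)=\sum_{i=1}^{b}V(a,i)$. It is known that $V(a,b)$ is constant for all sufficiently large $b$ (for instance for $b\ge a+1$); this eventual constant value is the constant congruence speed $V(a)$. By convention, $V(0)=V(1)=0$. *)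

theory Defs
  imports "HOL-Number_Theory.Number_Theory"
begin

(* The value at height 0 is the usual convention; it makes tetration a 1 = a ^ 1 = a,
   the starting value of the recursion. *)
primrec tetration :: "nat \<Rightarrow> nat \<Rightarrow> nat" where
  "tetration a 0 = 1"
| "tetration a (Suc b) = a ^ tetration a b"

(* Meaningful for b \<ge> 1 and a \<ge> 2 not divisible by 10: the two towers are then distinct, so
   the congruence modulo 10^n holds exactly up to one largest n. *)
definition stable_digits :: "nat \<Rightarrow> nat \<Rightarrow> nat" where
  "stable_digits a b =
     (THE n. [tetration a b = tetration a (b + 1)] (mod 10 ^ n) \<and>
             \<not> [tetration a b = tetration a (b + 1)] (mod 10 ^ (n + 1)))"

(* Integer-valued, so that the subtraction is not truncated; meaningful for b \<ge> 1. *)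
definition congruence_speed :: "nat \<Rightarrow> nat \<Rightarrow> int" where
  "congruence_speed a b =
     (if b = 1 then int (stable_digits a 1)
      else int (stable_digits a b) - int (stable_digits a (b - 1)))"

(* For a = 0 and a = 1 the value 0 is a convention (all towers of 1 coincide, so stable_digits
   would be undefined there). *)
definition constant_congruence_speed :: "nat \<Rightarrow> int" where
  "constant_congruence_speed a =
     (if a = 0 \<or> a = 1 then 0
      else (THE v. eventually (\<lambda>b. congruence_speed a b = v) sequentially))"

(* For p prime and x \<noteq> 0. At x = 0 the library sets multiplicity to 0. *)
abbreviation val :: "int \<Rightarrow> int \<Rightarrow> int" where
  "val p x \<equiv> int (multiplicity p x)"

end

theory Submission
  imports Defs
begin

text \<open>
  Put $D_b = {}^{b+1}a - {}^{b}a$, so that $\#S(a,b) = \min\{v_2(D_b), v_5(D_b)\}$ and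
  $D_{b+1} = a^{({}^{b}a)} (a^{D_b} - 1)$. Since $4 \mid D_b$ for $b \ge 2$, lifting the
  exponent with base $a^2$ at $2$ and base $a^4$ at $5$ shows that, for $p \in \{2, 5\}$ not
  dividing $a$, the valuation $v_p(D_b)$ grows in each step by the constant
  $v_2(a^2-1) - 1$ or $v_5(a^4-1)$. If $p$ divides $a$ instead, then $v_p(D_b)$ grows
  exponentially at least and does not affect the minimum. Hence $V(a)$ is the minimum of the
  constants belonging to the primes that do not divide $a$; in the factorisation
  $a^4 - 1 = (a-1)(a+1)(a^2+1)$ at most one factor is divisible by $5$, and the residues of
  $a$ modulo $4$ and $25$ decide the rest.
\<close>

section \<open>Lifting the exponent\<close>

text \<open>Writing \<open>x = 1 + p k\<close> gives \<open>x ^ i = 1 + p k i\<close> modulo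
  \<open>p^2\<close>, so only the term linear in \<open>k\<close> has to vanish. The congruence
  serves to show that the geometric sum has \<open>p\<close>-adic valuation exactly 1.\<close>

lemma cong_geometric_sum_prime:
  fixes x :: int
  assumes p: "prime p" and dvd: "int p dvd x - 1" and two: "p = 2 \<Longrightarrow> 4 dvd x - 1"
  shows "[(\<Sum>i<p. x ^ i) = int p] (mod (int p)^2)"
proof -
  obtain k where k: "x = 1 + int p * k"
    using dvd by (metis add.commute diff_add_cancel dvdE)
  have lin: "[x ^ i = 1 + int p * k * int i] (mod (int p)^2)" for i
  proof (induction i)
    case (Suc i)
    have "[x ^ Suc i = (1 + int p * k) * (1 + int p * k * int i)] (mod (int p)^2)"
      using cong_mult[OF cong_refl Suc, of x] by (simp add: k)
    also have "(1 + int p * k) * (1 + int p * k * int i)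
                 = 1 + int p * k * int (Suc i) + (int p)^2 * (k^2 * int i)"
      by (simp add: algebra_simps power2_eq_square)
    also have "[\<dots> = 1 + int p * k * int (Suc i)] (mod (int p)^2)"
      by (simp add: cong_iff_dvd_diff)
    finally show ?case .
  qed simp
  have "[(\<Sum>i<p. x ^ i) = (\<Sum>i<p. 1 + int p * k * int i)] (mod (int p)^2)"
    by (intro cong_sum lin)
  also have "(\<Sum>i<p. 1 + int p * k * int i) = int p + int p * k * int (\<Sum>i<p. i)"
    by (simp add: sum.distrib sum_distrib_left)
  also have "[\<dots> = int p] (mod (int p)^2)"
  proof -
    \<comment> \<open>A second factor \<open>p\<close> removes the linear term: for odd
      \<open>p\<close> it comes from \<open>p (p - 1) / 2\<close>, for \<open>p = 2\<close> the
      hypothesis modulo 4 makes \<open>k\<close> even.\<close>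
    have "int p dvd k * int (\<Sum>i<p. i)"
    proof (cases "p = 2")
      case True
      then have "2 dvd k" using two k by auto
      with True show ?thesis by simp
    next
      case False
      then have "odd p" using p prime_odd_nat prime_ge_2_nat by (metis le_neq_implies_less)
      moreover have "2 * (\<Sum>i<p. i) = p * (p - 1)"
        using gauss_sum_nat[of "p - 1"] prime_gt_0_nat[OF p]
        by (cases p) (simp_all add: lessThan_Suc_atMost atMost_atLeast0 algebra_simps)
      ultimately have "p dvd (\<Sum>i<p. i)"
        by (metis coprime_dvd_mult_right_iff coprime_right_2_iff_odd dvd_triv_left)
      then show ?thesis by (metis dvd_mult int_dvd_int_iff)
    qed
    then show ?thesis
      by (auto simp: cong_iff_dvd_diff power2_eq_square mult.assoc intro: mult_dvd_mono)
  qed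
  finally show ?thesis .
qed

lemma geometric_sum_int: "(x::int) ^ n - 1 = (x - 1) * (\<Sum>i<n. x ^ i)"
  using power_diff_1_eq[of x n] by simp

text \<open>Strong induction strips one factor \<open>p\<close> off the exponent at a time. This
  replaces \<open>x\<close> by \<open>x ^ p\<close>, hence \<open>x\<close> stays arbitrary in the
  induction.\<close>

lemma multiplicity_power_minus_1:
  fixes x :: int
  assumes p: "prime p" and dvd: "int p dvd x - 1" and two: "p = 2 \<Longrightarrow> 4 dvd x - 1"
    and x: "x > 1" and n: "n > 0"
  shows "multiplicity (int p) (x ^ n - 1) = multiplicity (int p) (x - 1) + multiplicity p n"
  using dvd two x n
proof (induction n arbitrary: x rule: less_induct)
  case (less n x)
  have pp: "prime_elem (int p)" using p by simp
  have pow_gt: "x ^ m > 1" if "m > 0" for m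
    using less.prems that by (simp add: one_less_power)
  have factor: "multiplicity (int p) (x ^ m - 1)
      = multiplicity (int p) (x - 1) + multiplicity (int p) (\<Sum>i<m. x ^ i)" if "m > 0" for m
    unfolding geometric_sum_int using pow_gt[OF that] less.prems geometric_sum_int[of x m]
    by (intro prime_elem_multiplicity_mult_distrib pp) auto
  have x1: "[x = 1] (mod int p)"
    using less.prems by (simp add: cong_iff_dvd_diff)
  show ?case
  proof (cases "p dvd n")
    case False
    \<comment> \<open>The geometric sum is \<open>n\<close> modulo \<open>p\<close>, so it adds
      nothing to the valuation.\<close>
    have "[(\<Sum>i<n. x ^ i) = (\<Sum>i<n. 1 ^ i)] (mod int p)"
      by (intro cong_sum cong_pow x1)
    then have "\<not> int p dvd (\<Sum>i<n. x ^ i)"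
      using False by (simp add: cong_dvd_iff)
    then show ?thesis
      using False less.prems by (simp add: factor not_dvd_imp_multiplicity_0)
  next
    case True
    then obtain m where m: "n = p * m" by blast
    with less.prems have m0: "m > 0" by auto
    have mn: "m < n" using m m0 prime_gt_1_nat[OF p] by simp
    \<comment> \<open>By this divisibility the hypotheses on \<open>x\<close> pass to
      \<open>x ^ p\<close>.\<close>
    have "x - 1 dvd x ^ p - 1" unfolding geometric_sum_int by simp
    then have "multiplicity (int p) ((x ^ p) ^ m - 1)
        = multiplicity (int p) (x ^ p - 1) + multiplicity p m"
      using less.prems(1,2) pow_gt[OF prime_gt_0_nat[OF p]] m0
      by (intro less.IH mn) (auto intro: dvd_trans)
    moreover have "multiplicity (int p) (\<Sum>i<p. x ^ i) = 1"
    proof -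
      have *: "[(\<Sum>i<p. x ^ i) = int p] (mod (int p)^2)"
        by (rule cong_geometric_sum_prime[OF p less.prems(1,2)])
      then have "[(\<Sum>i<p. x ^ i) = int p] (mod int p)"
        by (rule cong_dvd_modulus) (simp add: power2_eq_square)
      then have "int p dvd (\<Sum>i<p. x ^ i)"
        by (simp add: cong_dvd_iff)
      moreover have "\<not> (int p)^2 dvd (\<Sum>i<p. x ^ i)"
      proof -
        have "\<not> p^2 dvd p" using prime_gt_1_nat[OF p]
          by (metis dvd_imp_le le_square less_le_not_le nat_mult_1_right
              nat_mult_less_cancel1 not_less power2_eq_square prime_gt_0_nat p)
        then have "\<not> (int p)^2 dvd int p" by (metis int_dvd_int_iff of_nat_power)
        with * show ?thesis by (simp add: cong_dvd_iff)
      qed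
      ultimately show ?thesis
        by (intro multiplicity_eqI) (auto simp: numeral_2_eq_2)
    qed
    moreover have "multiplicity p n = Suc (multiplicity p m)"
      using m0 p unfolding m by (intro multiplicity_times_same) auto
    ultimately show ?thesis
      using factor[OF prime_gt_0_nat[OF p]] by (simp add: m power_mult)
  qed
qed

section \<open>Differences of consecutive towers and their valuations\<close>

definition tower_diff :: "nat \<Rightarrow> nat \<Rightarrow> int" where
  "tower_diff a b = int (tetration a (Suc b)) - int (tetration a b)"

lemma tetration_less_Suc: "a \<ge> 2 \<Longrightarrow> tetration a b < tetration a (Suc b)"
  by (induction b) auto

lemma tetration_gt: "a \<ge> 2 \<Longrightarrow> b < tetration a b"
proof (induction b)
  case (Suc b)
  then show ?case using tetration_less_Suc[of a b] by simp
qed simp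

lemma tower_diff_pos: "a \<ge> 2 \<Longrightarrow> tower_diff a b > 0"
  unfolding tower_diff_def using tetration_less_Suc[of a b] by simp

text \<open>The two exponents differ by \<open>tower_diff a b\<close>, so the smaller power factors
  out. The difference is positive, and \<open>nat\<close> merely turns it into an exponent.\<close>

lemma tower_diff_Suc:
  assumes "a \<ge> 2"
  shows "tower_diff a (Suc b) = int a ^ tetration a b * (int a ^ nat (tower_diff a b) - 1)"
proof -
  have "tetration a (Suc b) = tetration a b + nat (tower_diff a b)"
    unfolding tower_diff_def using tetration_less_Suc[OF assms, of b] by linarith
  then have "a ^ tetration a (Suc b) = a ^ tetration a b * a ^ nat (tower_diff a b)"
    by (metis power_add)
  then show ?thesis
    unfolding tower_diff_def[of a "Suc b"] tetration.simps(2)[of a "Suc b"]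
    by (simp add: algebra_simps)
qed

text \<open>For even \<open>a\<close> both towers have exponents at least 2; for odd
  \<open>a\<close> every tower is congruent to \<open>a\<close> modulo 4, because
  \<open>a ^ 2\<close> is 1. Height 1 fails when \<open>a\<close> is 2 modulo 4, whence the bound on
  \<open>b\<close>.\<close>

lemma four_dvd_tower_diff:
  assumes a: "a \<ge> 2" and b: "b \<ge> 2"
  shows "4 dvd tower_diff a b"
proof -
  have even_case: "4 dvd tetration a (Suc c)" if "even a" "c \<ge> 1" for c
  proof -
    have "2 \<le> tetration a c" using tetration_gt[OF a, of c] that by simp
    then have "a ^ 2 dvd tetration a (Suc c)" by (simp add: le_imp_power_dvd)
    moreover have "2 ^ 2 dvd a ^ 2" using that by (intro dvd_power_same)
    ultimately show ?thesis by (auto intro: dvd_trans)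
  qed
  have odd_case: "[a ^ t = a] (mod 4)" if "odd a" "odd t" for t
  proof -
    obtain k where k: "t = 2 * k + 1" using \<open>odd t\<close> by (rule oddE)
    have "a mod 4 = 1 \<or> a mod 4 = 3" using \<open>odd a\<close> by presburger
    then have "[a = 1] (mod 4) \<or> [a = 3] (mod 4)" by (simp add: cong_def)
    then have "[a ^ 2 = 1] (mod 4)"
    proof
      assume "[a = 1] (mod 4)"
      from cong_pow[OF this, of 2] show ?thesis by simp
    next
      assume "[a = 3] (mod 4)"
      from cong_pow[OF this, of 2] show ?thesis by (simp add: cong_def)
    qed
    then have "[a * (a ^ 2) ^ k = a * 1 ^ k] (mod 4)" by (intro cong_mult cong_pow) auto
    then show ?thesis by (simp add: k power_mult)
  qed
  obtain c where c: "b = Suc c" "c \<ge> 1" using b by (cases b) auto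
  have "[tetration a (Suc b) = tetration a b] (mod 4)"
  proof (cases "even a")
    case True
    then show ?thesis
      using even_case[of c] even_case[of b] b c unfolding cong_def
      by (metis dvd_eq_mod_eq_0 le_SucI)
  next
    case False
    have "odd (tetration a i)" for i by (induction i) (use False in auto)
    then show ?thesis using odd_case False c by (metis cong_sym cong_trans tetration.simps(2))
  qed
  then have "[int (tetration a (Suc b)) = int (tetration a b)] (mod 4)"
    by (metis cong_int_iff of_nat_numeral)
  then show ?thesis unfolding tower_diff_def cong_iff_dvd_diff .
qed

lemma multiplicity_mult_not_dvd:
  assumes "prime (p::int)" "\<not> p dvd y" "x \<noteq> 0"
  shows "multiplicity p (x * y) = multiplicity p x"
  using assms by (subst prime_elem_multiplicity_mult_distrib)
    (auto simp: not_dvd_imp_multiplicity_0)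

lemma multiplicity_of_nat_int:
  assumes "prime p" "n > 0"
  shows "multiplicity (int p) (int n) = multiplicity p n"
proof (rule multiplicity_eqI)
  show "int p ^ multiplicity p n dvd int n"
    by (metis int_dvd_int_iff multiplicity_dvd of_nat_power)
  have "\<not> p ^ Suc (multiplicity p n) dvd n"
    using assms by (subst power_dvd_iff_le_multiplicity) (auto dest: prime_gt_1_nat)
  then show "\<not> int p ^ Suc (multiplicity p n) dvd int n"
    by (metis int_dvd_int_iff of_nat_power)
qed

text \<open>The power of \<open>a\<close> in front is prime to \<open>p\<close>. In the other factor
  the exponent is \<open>d m\<close>, and lifting the exponent applies to the base
  \<open>a ^ d\<close> with exponent \<open>m\<close>; the valuation of \<open>m\<close> is that of
  the difference less that of \<open>d\<close>, which explains the correction term.\<close>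

lemma multiplicity_tower_diff_Suc:
  assumes a: "a \<ge> 2" and b: "b \<ge> 2" and p: "prime p" "\<not> p dvd a"
    and d: "d > 0" "d dvd 4"
    and base: "int p dvd int a ^ d - 1" "p = 2 \<Longrightarrow> 4 dvd int a ^ d - 1"
  shows "val (int p) (tower_diff a (Suc b)) =
    val (int p) (tower_diff a b) + (val (int p) (int a ^ d - 1) - multiplicity p d)"
proof -
  have pp: "prime (int p)" using p by simp
  define D where "D = nat (tower_diff a b)"
  have D: "int D = tower_diff a b" "D > 0" using tower_diff_pos[OF a, of b] by (auto simp: D_def)
  have "4 dvd D" using four_dvd_tower_diff[OF a b] D(1)
    by (metis int_dvd_int_iff of_nat_numeral)
  then obtain m where m: "D = d * m" using d by (metis dvdE dvd_trans)
  have m0: "m > 0" using m D by auto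
  have "\<not> int p dvd int a ^ tetration a b"
    using p by (metis pp int_dvd_int_iff of_nat_power prime_dvd_power p(1))
  moreover have "int a ^ D - 1 \<noteq> 0"
    using one_less_power[of "int a" D] a D by linarith
  ultimately have "multiplicity (int p) (tower_diff a (Suc b)) = multiplicity (int p) (int a ^ D - 1)"
    unfolding tower_diff_Suc[OF a] D_def[symmetric]
    by (subst mult.commute) (intro multiplicity_mult_not_dvd[OF pp])
  also have "\<dots> = multiplicity (int p) ((int a ^ d) ^ m - 1)" by (simp add: m power_mult)
  also have "\<dots> = multiplicity (int p) (int a ^ d - 1) + multiplicity p m"
    using a d m0 base by (intro multiplicity_power_minus_1 p) (auto simp: one_less_power)
  finally have 1: "multiplicity (int p) (tower_diff a (Suc b))
    = multiplicity (int p) (int a ^ d - 1) + multiplicity p m" .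
  have "multiplicity (int p) (int D) = multiplicity p D" by (rule multiplicity_of_nat_int[OF p(1) D(2)])
  also have "\<dots> = multiplicity p d + multiplicity p m"
    unfolding m using d m0 p by (intro prime_elem_multiplicity_mult_distrib) auto
  finally show ?thesis using 1 D by simp
qed

text \<open>The base is \<open>a ^ 2\<close>, since \<open>a\<close> itself may be 3 modulo 4; the
  correction is the valuation of \<open>d = 2\<close>.\<close>

lemma val_two_tower_diff_Suc:
  assumes "a \<ge> 2" "odd a" "b \<ge> 2"
  shows "val 2 (tower_diff a (Suc b)) = val 2 (tower_diff a b) + (val 2 ((int a)^2 - 1) - 1)"
proof -
  have "4 dvd (int a)^2 - 1"
  proof -
    obtain k where "int a = 2 * k + 1" using assms by (metis even_of_nat oddE)
    then show ?thesis by (simp add: power2_eq_square algebra_simps)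
  qed
  then show ?thesis
    using multiplicity_tower_diff_Suc[of a b 2 2] assms by (auto intro: dvd_trans[of 2 4])
qed

text \<open>The base \<open>a ^ 4\<close> is 1 modulo 5 by Fermat, and \<open>d = 4\<close> is prime
  to 5, so no correction appears.\<close>

lemma val_five_tower_diff_Suc:
  assumes "a \<ge> 2" "\<not> 5 dvd a" "b \<ge> 2"
  shows "val 5 (tower_diff a (Suc b)) = val 5 (tower_diff a b) + val 5 ((int a)^4 - 1)"
proof -
  have "[a ^ 4 = 1] (mod 5)"
    using fermat_theorem[of 5 a] assms by simp
  then have "5 dvd (int a)^4 - 1"
    using cong_int_iff[of "a^4" 1 5] by (simp add: cong_iff_dvd_diff)
  moreover have "multiplicity 5 (4::nat) = 0" by (rule not_dvd_imp_multiplicity_0) simp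
  ultimately show ?thesis
    using multiplicity_tower_diff_Suc[of a b 5 4] assms by auto
qed

text \<open>The power of \<open>a\<close> in front already contributes its exponent
  \<open>tetration a (Suc b)\<close>, which is at least \<open>2 ^ b\<close>. This crude bound beats
  every affine sequence.\<close>

lemma multiplicity_tower_diff_ge:
  assumes a: "a \<ge> 2" and p: "prime p" "p dvd a"
  shows "multiplicity (int p) (tower_diff a (Suc (Suc b))) \<ge> 2 ^ b"
proof (rule multiplicity_geI)
  have "2 ^ b \<le> a ^ tetration a b"
    using tetration_gt[OF a, of b] a
    by (meson le_trans less_imp_le_nat power_increasing power_mono one_le_numeral zero_le_numeral)
  moreover have "int p ^ tetration a (Suc b) dvd int a ^ tetration a (Suc b)"
    using p by (intro dvd_power_same) simp
  ultimately show "int p ^ 2 ^ b dvd tower_diff a (Suc (Suc b))"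
    unfolding tower_diff_Suc[OF a, of "Suc b"]
    by (intro dvd_mult2) (auto intro: dvd_trans le_imp_power_dvd)
  show "\<not> is_unit (int p)" using p by (auto dest: prime_gt_1_nat)
  show "tower_diff a (Suc (Suc b)) \<noteq> 0" using tower_diff_pos[OF a, of "Suc (Suc b)"] by simp
qed

section \<open>From valuations to the congruence speed\<close>

text \<open>The congruence modulo \<open>10 ^ n\<close> holds exactly for \<open>n\<close> up to the
  minimum, so the definite description has this minimum as its only solution.\<close>

lemma stable_digits_eq:
  assumes a: "a \<ge> 2"
  shows "stable_digits a b = min (multiplicity 2 (tower_diff a b)) (multiplicity 5 (tower_diff a b))"
proof -
  have D: "tower_diff a b \<noteq> 0" using tower_diff_pos[OF a, of b] by simp
  have iff: "[tetration a b = tetration a (b + 1)] (mod 10 ^ n)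
      \<longleftrightarrow> n \<le> min (multiplicity 2 (tower_diff a b)) (multiplicity 5 (tower_diff a b))" for n
  proof -
    have "[tetration a b = tetration a (b + 1)] (mod 10 ^ n)
        \<longleftrightarrow> [int (tetration a (Suc b)) = int (tetration a b)] (mod 10 ^ n)"
      using cong_int_iff[of "tetration a (Suc b)" "tetration a b" "10 ^ n"]
      by (auto simp: cong_sym_eq)
    also have "\<dots> \<longleftrightarrow> (2 * 5) ^ n dvd tower_diff a b"
      by (simp add: cong_iff_dvd_diff tower_diff_def)
    also have "\<dots> \<longleftrightarrow> 2 ^ n dvd tower_diff a b \<and> 5 ^ n dvd tower_diff a b"
    proof -
      have "coprime ((2::int) ^ n) (5 ^ n)"
        by (intro coprime_power_left_iff[THEN iffD2] coprime_power_right_iff[THEN iffD2] disjI1)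
           (simp add: primes_coprime)
      then show ?thesis unfolding power_mult_distrib
        by (metis divides_mult dvd_mult_left dvd_mult_right)
    qed
    also have "\<dots> \<longleftrightarrow> n \<le> min (multiplicity 2 (tower_diff a b)) (multiplicity 5 (tower_diff a b))"
      using D by (simp add: power_dvd_iff_le_multiplicity)
    finally show ?thesis .
  qed
  show ?thesis unfolding stable_digits_def iff by (rule the_equality) auto
qed

lemma constant_congruence_speedI:
  assumes a: "a \<ge> 2"
    and ev: "eventually (\<lambda>b. int (stable_digits a (Suc b)) = int (stable_digits a b) + v) sequentially"
  shows "constant_congruence_speed a = v"
proof -
  \<comment> \<open>Taking \<open>b > 0\<close> avoids height 1, where the speed is not defined as a
    difference.\<close>
  have "eventually (\<lambda>b. congruence_speed a (Suc b) = v) sequentially"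
    using ev eventually_gt_at_top[of 0]
    by eventually_elim (simp add: congruence_speed_def)
  then have *: "eventually (\<lambda>b. congruence_speed a b = v) sequentially"
    using eventually_sequentially_Suc by blast
  have "w = v" if "eventually (\<lambda>b. congruence_speed a b = w) sequentially" for w
  proof -
    have "eventually (\<lambda>b. w = v) sequentially"
      using that * by eventually_elim simp
    then show ?thesis by simp
  qed
  then have "(THE v. eventually (\<lambda>b. congruence_speed a b = v) sequentially) = v"
    by (rule the_equality[of "\<lambda>v. eventually (\<lambda>b. congruence_speed a b = v) sequentially", OF *])
  then show ?thesis
    using a by (simp add: constant_congruence_speed_def)
qed

section \<open>Minima of growing sequences\<close>

lemma affine_from:
  fixes f :: "nat \<Rightarrow> int"
  assumes "\<And>b. b \<ge> k \<Longrightarrow> f (Suc b) = f b + e" "b \<ge> k"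
  shows "f b = f k - int k * e + int b * e"
  using assms(2) by (induction b rule: dec_induct) (simp_all add: assms(1) algebra_simps)

text \<open>The sequence of smaller slope eventually lies below the other and is then the minimum.
  For equal slopes both arguments of the minimum shift by the same amount, whichever is
  smaller.\<close>

lemma eventually_min_Suc:
  fixes f g :: "nat \<Rightarrow> int"
  assumes f: "\<And>b. b \<ge> k \<Longrightarrow> f (Suc b) = f b + e"
    and g: "\<And>b. b \<ge> k \<Longrightarrow> g (Suc b) = g b + e'"
  shows "eventually (\<lambda>b. min (f (Suc b)) (g (Suc b)) = min (f b) (g b) + min e e') sequentially"
proof -
  have less: "eventually (\<lambda>b. F b \<le> G b) sequentially"
    if "\<And>b. b \<ge> k \<Longrightarrow> F (Suc b) = F b + x" "\<And>b. b \<ge> k \<Longrightarrow> G (Suc b) = G b + y" "x < y"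
    for F G :: "nat \<Rightarrow> int" and x y
  proof -
    \<comment> \<open>The difference of the intercepts at 0 of the affine formulas. The slopes are
      distinct integers, so \<open>y - x\<close> is at least 1 and \<open>b \<ge> c\<close>
      suffices.\<close>
    define c where "c = (F k - int k * x) - (G k - int k * y)"
    have "eventually (\<lambda>b. b \<ge> max k (nat c)) sequentially" by (rule eventually_ge_at_top)
    then show ?thesis
    proof eventually_elim
      case (elim b)
      have "c \<le> int b * 1" using elim by auto
      also have "\<dots> \<le> int b * (y - x)" using that by (intro mult_left_mono) auto
      finally show ?case
        using affine_from[of k F x b] affine_from[of k G y b] that elim
        by (simp add: c_def algebra_simps)
    qed
  qed
  consider "e < e'" | "e' < e" | "e = e'" by linarith
  then show ?thesis
  proof cases
    case 1
    have *: "eventually (\<lambda>b. f b \<le> g b) sequentially" using less f g 1 by blast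
    show ?thesis using * eventually_ge_at_top[of k]
      by eventually_elim (use 1 f g in auto)
  next
    case 2
    have *: "eventually (\<lambda>b. g b \<le> f b) sequentially" using less f g 2 by blast
    show ?thesis using * eventually_ge_at_top[of k]
      by eventually_elim (use 2 f g in auto)
  next
    case 3
    show ?thesis using eventually_ge_at_top[of k]
      by eventually_elim (use 3 f g in auto)
  qed
qed

lemma square_le_two_power: "(n::nat) \<ge> 4 \<Longrightarrow> n\<^sup>2 \<le> 2 ^ n"
proof (induction n rule: nat_induct_at_least)
  case (Suc n)
  have "4 * n \<le> n * n" using Suc by simp
  moreover have "(Suc n)\<^sup>2 = n * n + 2 * n + 1" by (simp add: power2_eq_square)
  ultimately have "(Suc n)\<^sup>2 \<le> 2 * n\<^sup>2" using Suc unfolding power2_eq_square by linarith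
  with Suc show ?case by simp
qed simp

text \<open>An affine \<open>f\<close> eventually stays below an exponential lower bound of
  \<open>g\<close>, so the minimum is \<open>f\<close> at both \<open>b\<close> and
  \<open>Suc b\<close>.\<close>

lemma eventually_min_Suc_exponential:
  fixes f g :: "nat \<Rightarrow> int"
  assumes f: "\<And>b. b \<ge> k \<Longrightarrow> f (Suc b) = f b + e"
    and g: "\<And>b. g (Suc (Suc b)) \<ge> 2 ^ b"
  shows "eventually (\<lambda>b. min (f (Suc b)) (g (Suc b)) = min (f b) (g b) + e) sequentially"
proof -
  \<comment> \<open>Chosen so that \<open>f (Suc (Suc b)) = c + b e\<close>, in step with the index
    shift in the bound on \<open>g\<close>.\<close>
  define c where "c = f k - int k * e + 2 * e"
  have "eventually (\<lambda>b. b \<ge> max 4 (nat (\<bar>c\<bar> + \<bar>e\<bar> + 1))) sequentially"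
    by (rule eventually_ge_at_top)
  then have "eventually (\<lambda>b::nat. c + int b * e \<le> 2 ^ b) sequentially"
  proof eventually_elim
    case (elim b)
    \<comment> \<open>The bounds \<open>e \<le> b - 1\<close> and \<open>c \<le> b\<close> add up to
      exactly \<open>b^2\<close>.\<close>
    then have "int b * e \<le> int b * (int b - 1)" "c \<le> int b" by (auto intro: mult_left_mono)
    then have "c + int b * e \<le> int (b\<^sup>2)" by (simp add: algebra_simps power2_eq_square)
    also have "b\<^sup>2 \<le> 2 ^ b" using elim by (intro square_le_two_power) simp
    finally show ?case by simp
  qed
  then have "eventually (\<lambda>b. f (Suc (Suc b)) \<le> g (Suc (Suc b))) sequentially"
    using eventually_ge_at_top[of k]
  proof eventually_elim
    case (elim b)
    then show ?case using affine_from[of k f e "Suc (Suc b)"] f g[of b]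
      by (simp add: c_def algebra_simps)
  qed
  then have *: "eventually (\<lambda>b. f b \<le> g b) sequentially"
    using eventually_sequentially_Suc[of "\<lambda>b. f b \<le> g b"]
      eventually_sequentially_Suc[of "\<lambda>b. f (Suc b) \<le> g (Suc b)"] by simp
  moreover have "eventually (\<lambda>b. f (Suc b) \<le> g (Suc b)) sequentially"
    using * eventually_sequentially_Suc[of "\<lambda>b. f b \<le> g b"] by simp
  ultimately show ?thesis using eventually_ge_at_top[of k]
    by eventually_elim (use f in auto)
qed

section \<open>The speed in terms of the growth constants\<close>

lemma constant_congruence_speed_coprime:
  assumes "a \<ge> 2" "odd a" "\<not> 5 dvd a"
  shows "constant_congruence_speed a = min (val 2 ((int a)^2 - 1) - 1) (val 5 ((int a)^4 - 1))"
  using eventually_min_Suc[where k = 2 and f = "\<lambda>b. val 2 (tower_diff a b)"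
      and g = "\<lambda>b. val 5 (tower_diff a b)",
      OF val_two_tower_diff_Suc val_five_tower_diff_Suc] assms
  by (intro constant_congruence_speedI) (simp_all add: stable_digits_eq of_nat_min)

text \<open>The 2-adic valuation outgrows the 5-adic one, so the latter alone sets the
  speed.\<close>

lemma constant_congruence_speed_even:
  assumes "a \<ge> 2" "even a" "\<not> 5 dvd a"
  shows "constant_congruence_speed a = val 5 ((int a)^4 - 1)"
proof -
  have "val 2 (tower_diff a (Suc (Suc b))) \<ge> 2 ^ b" for b
    using multiplicity_tower_diff_ge[of a 2 b] assms
    by (metis of_nat_le_iff of_nat_numeral of_nat_power two_is_prime_nat)
  from eventually_min_Suc_exponential[where k = 2 and f = "\<lambda>b. val 5 (tower_diff a b)",
      OF val_five_tower_diff_Suc this] show ?thesis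
    using assms by (intro constant_congruence_speedI)
      (simp_all add: stable_digits_eq of_nat_min min.commute)
qed

lemma constant_congruence_speed_five:
  assumes "a \<ge> 2" "odd a" "5 dvd a"
  shows "constant_congruence_speed a = val 2 ((int a)^2 - 1) - 1"
proof -
  have five: "prime (5::nat)" by simp
  have "val 5 (tower_diff a (Suc (Suc b))) \<ge> 2 ^ b" for b
    using multiplicity_tower_diff_ge[of a 5 b] assms
    by (metis five of_nat_le_iff of_nat_numeral of_nat_power)
  from eventually_min_Suc_exponential[where k = 2 and f = "\<lambda>b. val 2 (tower_diff a b)",
      OF val_two_tower_diff_Suc this] show ?thesis
    using assms by (intro constant_congruence_speedI)
      (simp_all add: stable_digits_eq of_nat_min)
qed

section \<open>Evaluating the growth constants\<close>

text \<open>Of the neighbours \<open>x - 1\<close> and \<open>x + 1\<close>, one is 2 modulo 4; its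
  valuation 1 cancels the subtracted 1.\<close>

lemma val_two_square_minus_1:
  assumes "(x::int) > 1"
  shows "x mod 4 = 1 \<Longrightarrow> val 2 (x^2 - 1) - 1 = val 2 (x - 1)"
    and "x mod 4 = 3 \<Longrightarrow> val 2 (x^2 - 1) - 1 = val 2 (x + 1)"
proof -
  have *: "x^2 - 1 = (x - 1) * (x + 1)" by (simp add: power2_eq_square algebra_simps)
  have mult: "multiplicity 2 (x^2 - 1) = multiplicity 2 (x - 1) + multiplicity 2 (x + 1)"
    unfolding * using assms by (intro prime_elem_multiplicity_mult_distrib) auto
  have one: "multiplicity 2 (y::int) = 1" if "y mod 4 = 2" for y
  proof (rule multiplicity_eqI)
    have "y mod 2 = y mod 4 mod 2" by (simp add: mod_mod_cancel)
    then show "2 ^ 1 dvd y" "\<not> 2 ^ Suc 1 dvd y" using that by (simp_all add: dvd_eq_mod_eq_0)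
  qed
  show "val 2 (x^2 - 1) - 1 = val 2 (x - 1)" if "x mod 4 = 1"
  proof -
    have "(x + 1) mod 4 = 2" using that by presburger
    then show ?thesis using mult one by simp
  qed
  show "val 2 (x^2 - 1) - 1 = val 2 (x + 1)" if "x mod 4 = 3"
  proof -
    have "(x - 1) mod 4 = 2" using that by presburger
    then show ?thesis using mult one by simp
  qed
qed

text \<open>The surviving neighbour is divisible by 4. Hence a 5-adic constant equal to 1 is always
  the minimum.\<close>

lemma val_two_square_minus_1_ge:
  assumes "(x::int) > 1" "odd x"
  shows "val 2 (x^2 - 1) - 1 \<ge> 2"
proof -
  have "multiplicity 2 y \<ge> 2" if "y > 0" "4 dvd y" for y :: int
    using that by (intro multiplicity_geI) auto
  note ge = this[of "x - 1"] this[of "x + 1"]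
  have "x mod 4 = 1 \<or> x mod 4 = 3" using assms(2) by presburger
  then consider "x mod 4 = 1" | "x mod 4 = 3" by blast
  then show ?thesis
  proof cases
    case 1
    then have "4 dvd x - 1" by presburger
    then show ?thesis using ge val_two_square_minus_1(1)[OF assms(1) 1] assms by simp
  next
    case 2
    then have "4 dvd x + 1" by presburger
    then show ?thesis using ge val_two_square_minus_1(2)[OF assms(1) 2] assms by simp
  qed
qed

lemma five_dvd_square_plus_1_iff:
  "5 dvd (x::int)^2 + 1 \<longleftrightarrow> x mod 5 = 2 \<or> x mod 5 = 3"
proof -
  have *: "(x^2 + 1) mod 5 = ((x mod 5)^2 + 1) mod 5"
    by (metis mod_add_left_eq power_mod)
  have "x mod 5 = 0 \<or> x mod 5 = 1 \<or> x mod 5 = 2 \<or> x mod 5 = 3 \<or> x mod 5 = 4"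
    using pos_mod_bound[of 5 x] pos_mod_sign[of 5 x] by linarith
  then show ?thesis unfolding dvd_eq_mod_eq_0 * by (elim disjE) simp_all
qed

lemma val_five_fourth_power_minus_1:
  assumes "(x::int) > 1"
  shows "x mod 5 = 1 \<Longrightarrow> val 5 (x^4 - 1) = val 5 (x - 1)"
    and "x mod 5 = 4 \<Longrightarrow> val 5 (x^4 - 1) = val 5 (x + 1)"
    and "x mod 5 = 2 \<or> x mod 5 = 3 \<Longrightarrow> val 5 (x^4 - 1) = val 5 (x^2 + 1)"
proof -
  have p: "prime_elem (5::int)" by simp
  have "x^4 - 1 = (x - 1) * (x + 1) * (x^2 + 1)" by (simp add: power_numeral_reduce algebra_simps)
  moreover have "x^2 + 1 \<noteq> 0" using zero_le_power2[of x] by linarith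
  ultimately have *: "val 5 (x^4 - 1) = val 5 (x - 1) + val 5 (x + 1) + val 5 (x^2 + 1)"
    using assms by (simp add: prime_elem_multiplicity_mult_distrib[OF p])
  have minus: "val 5 (x - 1) = 0" if "x mod 5 \<noteq> 1"
    using that by (simp add: mod_eq_dvd_iff[of x 5 1, simplified] not_dvd_imp_multiplicity_0)
  \<comment> \<open>The residue 4 is that of \<open>-1\<close>, so \<open>x + 1\<close> is read as
    \<open>x - (-1)\<close>.\<close>
  have plus: "val 5 (x + 1) = 0" if "x mod 5 \<noteq> 4"
    using that by (simp add: mod_eq_dvd_iff[of x 5 "-1", simplified] not_dvd_imp_multiplicity_0)
  have sq: "val 5 (x^2 + 1) = 0" if "\<not> (x mod 5 = 2 \<or> x mod 5 = 3)"
    using that by (simp add: five_dvd_square_plus_1_iff not_dvd_imp_multiplicity_0)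
  show "x mod 5 = 1 \<Longrightarrow> val 5 (x^4 - 1) = val 5 (x - 1)" using * plus sq by simp
  show "x mod 5 = 4 \<Longrightarrow> val 5 (x^4 - 1) = val 5 (x + 1)" using * minus sq by simp
  show "x mod 5 = 2 \<or> x mod 5 = 3 \<Longrightarrow> val 5 (x^4 - 1) = val 5 (x^2 + 1)"
    using * minus plus by auto
qed

text \<open>The residues 1, 7, 18, 24 are the fourth roots of unity modulo 25, one above each
  nonzero residue modulo 5. Away from them 25 does not divide \<open>x^4 - 1\<close>, while 5 still
  does.\<close>

lemma val_five_fourth_power_minus_1_eq_1:
  assumes x: "(x::int) > 1" "x mod 5 \<noteq> 0"
    and not_root: "x mod 25 \<notin> {1, 7, 18, 24}"
  shows "val 5 (x^4 - 1) = 1"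
proof -
  have one: "multiplicity 5 (y::int) = 1" if "5 dvd y" "\<not> 25 dvd y" for y
    using that by (intro multiplicity_eqI) simp_all
  have "x mod 5 = 1 \<or> x mod 5 = 4 \<or> x mod 5 = 2 \<or> x mod 5 = 3"
    using x(2) pos_mod_bound[of 5 x] pos_mod_sign[of 5 x] by linarith
  then consider "x mod 5 = 1" | "x mod 5 = 4" | "x mod 5 = 2 \<or> x mod 5 = 3" by blast
  then show ?thesis
  proof cases
    case 1
    moreover have "5 dvd x - 1" "\<not> 25 dvd x - 1"
      using 1 not_root mod_eq_dvd_iff[of x 5 1] mod_eq_dvd_iff[of x 25 1] by simp_all
    ultimately show ?thesis using one val_five_fourth_power_minus_1(1)[OF x(1)] by simp
  next
    case 2
    moreover have "5 dvd x + 1" "\<not> 25 dvd x + 1"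
      using 2 not_root mod_eq_dvd_iff[of x 5 "-1"] mod_eq_dvd_iff[of x 25 "-1"] by simp_all
    ultimately show ?thesis using one val_five_fourth_power_minus_1(2)[OF x(1)] by simp
  next
    case 3
    have *: "(x^2 + 1) mod 25 = ((x mod 25)^2 + 1) mod 25" by (metis mod_add_left_eq power_mod)
    define q where "q = x mod 25 div 5"
    have "x mod 25 = 5 * q + x mod 25 mod 5" by (simp add: q_def)
    then have x25: "x mod 25 = 5 * q + x mod 5" by (simp add: mod_mod_cancel)
    have "0 \<le> x mod 5" "x mod 5 < 5" "0 \<le> x mod 25" "x mod 25 < 25" by simp_all
    with x25 have "q = 0 \<or> q = 1 \<or> q = 2 \<or> q = 3 \<or> q = 4" by linarith
    \<comment> \<open>These are the lifts of 2 and 3 modulo 5 other than 7 and 18, the square roots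
      of -1 modulo 25.\<close>
    then have "x mod 25 \<in> {2, 3, 8, 12, 13, 17, 22, 23}"
      using 3 not_root unfolding x25 by (elim disjE) simp_all
    then have "\<not> 25 dvd x^2 + 1" unfolding dvd_eq_mod_eq_0 * by (elim insertE emptyE) simp_all
    then show ?thesis
      using 3 one val_five_fourth_power_minus_1(3)[OF x(1)] five_dvd_square_plus_1_iff by simp
  qed
qed

section \<open>Case analysis on the last two digits\<close>

theorem theorem2p1:
  fixes a :: nat
  assumes "a = 0 \<or> \<not> 10 dvd a"
  shows "constant_congruence_speed a =
    (if a = 0 \<or> a = 1 then 0
     else if [a = 1] (mod 100) then min (val 2 (int a - 1)) (val 5 (int a - 1))
     else if [a = 51] (mod 100) then min (val 2 (int a + 1)) (val 5 (int a - 1))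
     else if [a = 2] (mod 10) \<or> [a = 8] (mod 10) then val 5 ((int a)^2 + 1)
     else if [a = 7] (mod 100) \<or> [a = 43] (mod 100)
       then min (val 2 (int a + 1)) (val 5 ((int a)^2 + 1))
     else if [a = 57] (mod 100) \<or> [a = 93] (mod 100)
       then min (val 2 (int a - 1)) (val 5 ((int a)^2 + 1))
     else if [a = 4] (mod 10) then val 5 (int a + 1)
     else if [a = 5] (mod 10) then val 2 ((int a)^2 - 1) - 1
     else if [a = 6] (mod 10) then val 5 (int a - 1)
     else if [a = 49] (mod 100) then min (val 2 (int a - 1)) (val 5 (int a + 1))
     else if [a = 99] (mod 100) then min (val 2 (int a + 1)) (val 5 (int a + 1))
     else 1)"
proof (cases "a \<le> 1")
  case True
  then show ?thesis by (auto simp: constant_congruence_speed_def)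
next
  case False
  then have a: "a \<ge> 2" "a \<noteq> 0" "a \<noteq> 1" "int a > 1" by auto
  with assms have ten: "\<not> 10 dvd a" by simp
  note two = val_two_square_minus_1[OF a(4)] and five = val_five_fourth_power_minus_1[OF a(4)]
  \<comment> \<open>All branches depend on \<open>r\<close> and \<open>u\<close> only; since 4 and
    25 divide 100, \<open>r\<close> also carries the residues that the valuation lemmas use.\<close>
  define r u where "r = a mod 100" and "u = a mod 10"
  have conds: "[a = k] (mod 100) \<longleftrightarrow> r = k mod 100" "[a = k] (mod 10) \<longleftrightarrow> u = k mod 10" for k
    by (simp_all add: r_def u_def cong_def)
  have r: "r < 100" "u = r mod 10" "int a mod 4 = int (r mod 4)" "int a mod 5 = int (r mod 5)"
    "int a mod 25 = int (r mod 25)" "even a \<longleftrightarrow> even r"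
    by (simp_all add: r_def u_def mod_mod_cancel zmod_int dvd_mod_iff)
  have u: "int a mod 5 = int (u mod 5)" "even a \<longleftrightarrow> even u" "5 dvd a \<longleftrightarrow> 5 dvd u"
    by (simp_all add: u_def mod_mod_cancel zmod_int dvd_mod_iff)
  have "u \<noteq> 0" using ten by (simp add: u_def dvd_eq_mod_eq_0)
  moreover have "u \<in> {..<10}" by (simp add: u_def)
  then have "u \<in> {0, 1, 2, 3, 4, 5, 6, 7, 8, 9}"
    by (simp add: lessThan_nat_numeral lessThan_Suc) blast
  ultimately have u_cases: "u \<in> {1, 2, 3, 4, 5, 6, 7, 8, 9}" by simp
  have "\<not> (even u \<and> 5 dvd u)" using u_cases by (elim insertE emptyE) simp_all
  \<comment> \<open>In case \<open>root\<close>, \<open>a\<close> is a fourth root of unity modulo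
    25 and both constants may exceed 1; in case \<open>simple\<close> the 5-adic one is 1.\<close>
  then consider (even) "even u" "\<not> 5 dvd u" | (fivefold) "odd u" "5 dvd u"
    | (root) "odd u" "\<not> 5 dvd u" "r mod 25 \<in> {1, 7, 18, 24}"
    | (simple) "odd u" "\<not> 5 dvd u" "r mod 25 \<notin> {1, 7, 18, 24}"
    by blast
  then show ?thesis
  proof cases
    case even
    then have speed: "constant_congruence_speed a = val 5 ((int a)^4 - 1)"
      using constant_congruence_speed_even a u by blast
    have "u \<in> {2, 4, 6, 8}" using u_cases even by (elim insertE emptyE) simp_all
    then consider "u = 2 \<or> u = 8" | "u = 4" | "u = 6" by blast
    then show ?thesis
    proof cases
      case 1
      \<comment> \<open>This rules out the branches modulo 100, all of whose residues are
        odd.\<close>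
      have "r \<notin> {1, 51, 7, 43, 57, 93, 49, 99}" using 1 r(2) by auto
      moreover have "val 5 ((int a)^4 - 1) = val 5 ((int a)^2 + 1)"
        using u(1) 1 by (intro five(3)) auto
      ultimately show ?thesis using speed 1 a by (elim disjE) (simp_all add: conds)
    next
      case 2
      have "r \<notin> {1, 51, 7, 43, 57, 93, 49, 99}" using 2 r(2) by auto
      moreover have "val 5 ((int a)^4 - 1) = val 5 (int a + 1)"
        using u(1) 2 by (intro five(2)) auto
      ultimately show ?thesis using speed 2 a by (simp add: conds)
    next
      case 3
      have "r \<notin> {1, 51, 7, 43, 57, 93, 49, 99}" using 3 r(2) by auto
      moreover have "val 5 ((int a)^4 - 1) = val 5 (int a - 1)"
        using u(1) 3 by (intro five(1)) auto
      ultimately show ?thesis using speed 3 a by (simp add: conds)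
    qed
  next
    case fivefold
    then have "constant_congruence_speed a = val 2 ((int a)^2 - 1) - 1"
      using constant_congruence_speed_five a u by blast
    moreover have five: "u = 5" using u_cases fivefold by (elim insertE emptyE) simp_all
    moreover have "r \<notin> {1, 51, 7, 43, 57, 93, 49, 99}" using five r(2) by auto
    ultimately show ?thesis using a by (simp add: conds)
  next
    case root
    then have *: "constant_congruence_speed a
        = min (val 2 ((int a)^2 - 1) - 1) (val 5 ((int a)^4 - 1))"
      using constant_congruence_speed_coprime a u by blast
    \<comment> \<open>Each root modulo 25 has four lifts modulo 100, two of which are odd; this
      gives the eight residues of the formula.\<close>
    define q c where "q = r div 25" and "c = r mod 25"
    have r25: "r = 25 * q + c" by (simp add: q_def c_def)
    with r(1) have "q = 0 \<or> q = 1 \<or> q = 2 \<or> q = 3" by linarith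
    moreover have "odd r" using root(1) u(2) r(6) by blast
    ultimately have "r \<in> {1, 51, 7, 57, 43, 93, 49, 99}"
      using root(3) r25 unfolding c_def[symmetric] by (elim insertE emptyE disjE) simp_all
    \<comment> \<open>The residue of \<open>r\<close> modulo 4 selects \<open>a - 1\<close> or
      \<open>a + 1\<close> at 2, and the residue modulo 5 selects the factor at 5.\<close>
    then show ?thesis
      unfolding * using a r(2,3,4) two five by (elim insertE emptyE) (simp_all add: conds)
  next
    case simple
    then have "constant_congruence_speed a
        = min (val 2 ((int a)^2 - 1) - 1) (val 5 ((int a)^4 - 1))"
      using constant_congruence_speed_coprime a u by blast
    moreover have "val 5 ((int a)^4 - 1) = 1"
    proof (rule val_five_fourth_power_minus_1_eq_1[OF a(4)])
      show "int a mod 5 \<noteq> 0" using simple(2) by (simp add: u(1) dvd_eq_mod_eq_0)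
      show "int a mod 25 \<notin> {1, 7, 18, 24}" using simple(3) by (simp add: r(5))
    qed
    moreover have "val 2 ((int a)^2 - 1) - 1 \<ge> 2"
      using val_two_square_minus_1_ge[OF a(4)] simple(1) u(2) by simp
    ultimately have "constant_congruence_speed a = 1" by simp
    \<comment> \<open>All eight residues reduce to roots modulo 25, so only the last branch remains
      once the even digits and 5 are excluded.\<close>
    moreover have "r \<notin> {1, 51, 7, 43, 57, 93, 49, 99}" using simple by auto
    moreover have "u \<notin> {2, 8, 4, 5, 6}" using simple by auto
    ultimately show ?thesis using a by (simp add: conds)
  qed
qed

end
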